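(* Let $n\geq 1$ and let $\mathrm{Aut}_{\mathrm{hol}}(\mathbb C^n)$ denote the group of all biholomorphic maps $F:\mathbb C^n\to\mathbb C^n$. For $F\in \mathrm{Aut}_{\mathrm{hol}}(\mathbb C^n)$ put $\Theta(F)=DF(0)^{-1}(F-F(0))$, i.e. $\Theta(F)(z)=DF(0)^{-1}(F(z)-F(0))$, and define $$\mathfrak{X}^n(F)=\Big(F(0),\ DF(0),\ L\big(\log\|\Theta(F)\|\big)\Big)\in \mathbb C^n\times GL(n,\mathbb C)\times \mathfrak{L}^n(PSH),$$ where the third component is the Levi matrix of the function $z\mapsto \log\|\Theta(F)(z)\|$ on $\mathbb C^n\setminus\{0\}$. Then the map $\mathfrak{X}^n:\mathrm{Aut}_{\mathrm{hol}}(\mathbb C^n)\to \mathbb C^n\times GL(n,\mathbb C)\times \mathfrak{L}^n(PSH)$ is injective. Equivalently: if $F,G\in\mathrm{Aut}_{\mathrm{hol}}(\mathbb C^n)$ satisfy $F(0)=G(0)$, $DF(0)=DG(0)$, and $L(\log\|\Theta(F)\|)=L(\log\|\Theta(G)\|)$ on $\mathbb C^n\setminus\{0\}$, then $F=G$.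
   Context: $\|\cdot\|$ is the standard Hermitian (Euclidean) norm on $\mathbb C^n$. For a real-valued $C^2$ function $g$ on an open subset of $\mathbb C^n$, its Levi matrix (complex Hessian) is the Hermitian $n\times n$ matrix $L(g)=\big(\partial^2 g/\partial z_i\partial\bar z_j\big)_{i,j}$; $g$ is plurisubharmonic if $L(g)\ge 0$ everywhere and pluriharmonic if $L(g)=0$ everywhere. $\mathfrak{L}^n(PSH)$ denotes the set of Levi matrices $L(g)$ of real-analytic plurisubharmonic functions $g$ defined on $\mathbb C^n\setminus\{0\}$, viewed as a subset of the real-analytic maps $\mathbb C^n\setminus\{0\}\to\mathbb C^{n\times n}$. (Note $\Theta(F)(0)=0$, $D\Theta(F)(0)=I$ and $\Theta(F)$ is injective, so $\log\|\Theta(F)\|$ is a real-analytic plurisubharmonic function on $\mathbb C^n\setminus\{0\}$.) *)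

theory Defs
  imports "HOL-Analysis.Analysis"
begin

text \<open>C^n is modelled as complex ^ 'n for a finite index type 'n (so n = CARD('n) \<ge> 1).\<close>

definition cn_holomorphic_on ::
  "(complex ^ 'n \<Rightarrow> complex ^ 'm) \<Rightarrow> (complex ^ 'n) set \<Rightarrow> bool" where
  "cn_holomorphic_on F S \<longleftrightarrow>
     (\<forall>z\<in>S. \<exists>L. (F has_derivative L) (at z) \<and> (\<forall>c v. L (c *s v) = c *s L v))"

definition biholomorphic :: "(complex ^ 'n \<Rightarrow> complex ^ 'n) \<Rightarrow> bool" where
  "biholomorphic F \<longleftrightarrow> bij F \<and> cn_holomorphic_on F UNIV \<and> cn_holomorphic_on (inv F) UNIV"

definition DF0 :: "(complex ^ 'n \<Rightarrow> complex ^ 'n) \<Rightarrow> complex ^ 'n \<Rightarrow> complex ^ 'n" where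
  "DF0 F = frechet_derivative F (at 0)"

definition Theta :: "(complex ^ 'n \<Rightarrow> complex ^ 'n) \<Rightarrow> complex ^ 'n \<Rightarrow> complex ^ 'n" where
  "Theta F z = inv (DF0 F) (F z - F 0)"

definition dirderiv :: "(complex ^ 'n \<Rightarrow> complex) \<Rightarrow> complex ^ 'n \<Rightarrow> complex ^ 'n \<Rightarrow> complex" where
  "dirderiv h z v = vector_derivative (\<lambda>t::real. h (z + t *\<^sub>R v)) (at 0)"

definition wirt_z :: "'n \<Rightarrow> (complex ^ 'n \<Rightarrow> complex) \<Rightarrow> complex ^ 'n \<Rightarrow> complex" where
  "wirt_z j h z = (dirderiv h z (axis j 1) - \<i> * dirderiv h z (axis j \<i>)) / 2"

definition wirt_zbar :: "'n \<Rightarrow> (complex ^ 'n \<Rightarrow> complex) \<Rightarrow> complex ^ 'n \<Rightarrow> complex" where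
  "wirt_zbar j h z = (dirderiv h z (axis j 1) + \<i> * dirderiv h z (axis j \<i>)) / 2"

definition levi :: "(complex ^ 'n \<Rightarrow> real) \<Rightarrow> complex ^ 'n \<Rightarrow> complex ^ 'n ^ 'n" where
  "levi g z = (\<chi> i j. wirt_z i (wirt_zbar j (\<lambda>w. complex_of_real (g w))) z)"

end

theory Submission
  imports Defs "HOL-Complex_Analysis.Conformal_Mappings"
begin

text \<open>Write \<open>\<Phi> = Theta F\<close> and \<open>\<Psi> = Theta G\<close>, both normalised automorphisms. At a point \<open>z\<close>, the Levi form
of \<open>log \<parallel>\<Phi>\<parallel>\<close> in a direction \<open>u\<close> is, up to a positive factor, the defect in the Cauchy--Schwarz
inequality for the vectors \<open>\<Phi> z\<close> and \<open>D\<Phi> z u\<close>. Take \<open>z = \<Psi>\<^sup>-\<^sup>1(t v)\<close> with \<open>u\<close> the velocity of this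
curve in \<open>t\<close>: for \<open>\<Psi>\<close> the two vectors are \<open>t v\<close> and \<open>v\<close>, so the defect vanishes. Hence it vanishes
for \<open>\<Phi>\<close>, that is, the entire curve \<open>f t = \<Phi> (\<Psi>\<^sup>-\<^sup>1(t v))\<close> is parallel to its own derivative, and
\<open>f t = a t v\<close> with \<open>a\<close> entire, vanishing only at 0 and with \<open>a' 0 = 1\<close>. As \<open>\<Phi> \<circ> \<Psi>\<^sup>-\<^sup>1\<close> is a
homeomorphism, \<open>a\<close> stays away from 0 near infinity, so \<open>a t = t\<close> by Liouville and \<open>\<Phi> = \<Psi>\<close>.\<close>

subsection \<open>Entire functions of one variable\<close>

text \<open>The difference quotients in t with step 1/(n+1) are entire in s. By Taylor's formula
  with a Cauchy bound on the second t-derivative they converge uniformly on discs, so the limit is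
  holomorphic.\<close>

lemma holomorphic_on_deriv_parameter:
  fixes \<phi> :: "complex \<Rightarrow> complex \<Rightarrow> complex"
  assumes cont: "continuous_on UNIV (\<lambda>p. \<phi> (fst p) (snd p))"
    and hol1: "\<And>t. (\<lambda>s. \<phi> s t) holomorphic_on UNIV"
    and hol2: "\<And>s. \<phi> s holomorphic_on UNIV"
  shows "(\<lambda>s. deriv (\<phi> s) 0) holomorphic_on UNIV"
proof (rule holomorphic_uniform_sequence)
  define f where "f = (\<lambda>n s. (\<phi> s (of_real (inverse (real (Suc n)))) - \<phi> s 0) * of_real (real (Suc n)))"
  show "f n holomorphic_on UNIV" for n
    unfolding f_def by (intro holomorphic_intros hol1)
  fix x :: complex
  \<comment> \<open>Radius 2 in the second variable: unit circles around points of
    \<open>cball 0 1\<close>, on which the Cauchy estimate below is applied, stay inside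
    \<open>cball 0 2\<close>.\<close>
  have "compact (cball x 1 \<times> cball (0::complex) 2)"
    by (intro compact_Times compact_cball)
  then have "bounded ((\<lambda>p. \<phi> (fst p) (snd p)) ` (cball x 1 \<times> cball 0 2))"
    by (intro compact_imp_bounded compact_continuous_image continuous_on_subset[OF cont]) auto
  then obtain B where B: "\<And>s t. s \<in> cball x 1 \<Longrightarrow> t \<in> cball 0 2 \<Longrightarrow> norm (\<phi> s t) \<le> B"
    unfolding bounded_iff by (force simp del: mem_cball)
  have quotient: "norm (f n s - deriv (\<phi> s) 0) \<le> 2 * B * inverse (real (Suc n))"
    if s: "s \<in> cball x 1" for n s
  proof -
    define h where "h = inverse (real (Suc n))"
    have h: "0 < h" "h \<le> 1" by (auto simp: h_def field_simps)
    have "cmod ((deriv ^^ 0) (\<phi> s) (of_real h) -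
            (\<Sum>i\<le>1. (deriv ^^ i) (\<phi> s) 0 * (of_real h - 0) ^ i / fact i))
          \<le> (2 * B) * cmod (of_real h - 0) ^ Suc 1 / fact 1"
    proof (rule complex_Taylor[where S = "cball 0 1" and n = 1 and f = "\<lambda>i. (deriv ^^ i) (\<phi> s)"])
      show "((deriv ^^ i) (\<phi> s) has_field_derivative (deriv ^^ Suc i) (\<phi> s) t)
          (at t within cball 0 1)" for i t
        using holomorphic_derivI[OF holomorphic_higher_deriv[OF hol2 open_UNIV] open_UNIV]
          has_field_derivative_at_within by fastforce
      show "cmod ((deriv ^^ Suc 1) (\<phi> s) t) \<le> 2 * B" if t: "t \<in> cball 0 1" for t
      proof -
        have "norm ((deriv ^^ 2) (\<phi> s) t) \<le> fact 2 * B / 1 ^ 2"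
        proof (rule Cauchy_inequality)
          show "\<phi> s holomorphic_on ball t 1" "continuous_on (cball t 1) (\<phi> s)"
            using hol2 holomorphic_on_subset holomorphic_on_imp_continuous_on by blast+
          fix y assume "norm (t - y) = 1"
          then have "norm y \<le> 2"
            using t norm_triangle_ineq2[of y t] by (auto simp: norm_minus_commute)
          then show "norm (\<phi> s y) \<le> B" using B[OF s] by simp
        qed simp
        then show ?thesis by (simp add: numeral_2_eq_2)
      qed
    qed (use h in auto)
    then have "cmod (\<phi> s (of_real h) - \<phi> s 0 - deriv (\<phi> s) 0 * of_real h) \<le> 2 * B * h\<^sup>2"
      using h by (simp add: power2_eq_square algebra_simps)
    moreover have "f n s - deriv (\<phi> s) 0
        = (\<phi> s (of_real h) - \<phi> s 0 - deriv (\<phi> s) 0 * of_real h) / of_real h"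
    proof -
      have "of_real (real (Suc n)) = inverse (of_real h :: complex)" by (simp add: h_def)
      then have "f n s = (\<phi> s (of_real h) - \<phi> s 0) * inverse (of_real h)"
        by (simp only: f_def h_def)
      then show ?thesis using h by (simp add: field_simps)
    qed
    ultimately have "norm (f n s - deriv (\<phi> s) 0) \<le> 2 * B * h\<^sup>2 / h"
      using h by (simp add: norm_divide divide_right_mono)
    also have "2 * B * h\<^sup>2 / h = 2 * B * h" using h by (simp add: power2_eq_square)
    finally show ?thesis by (simp only: h_def)
  qed
  have "uniform_limit (cball x 1) f (\<lambda>s. deriv (\<phi> s) 0) sequentially"
  proof (rule uniform_limitI)
    fix e :: real assume "e > 0"
    have "(\<lambda>n. 2 * B * inverse (real (Suc n))) \<longlonglongrightarrow> 2 * B * 0"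
      by (intro tendsto_intros LIMSEQ_inverse_real_of_nat)
    then have "\<forall>\<^sub>F n in sequentially. 2 * B * inverse (real (Suc n)) < e"
      using \<open>e > 0\<close> by (intro order_tendstoD) auto
    then show "\<forall>\<^sub>F n in sequentially. \<forall>s\<in>cball x 1. dist (f n s) (deriv (\<phi> s) 0) < e"
      by eventually_elim (auto simp: dist_norm simp del: mem_cball intro: le_less_trans[OF quotient])
  qed
  then show "\<exists>d>0. cball x d \<subseteq> UNIV \<and> uniform_limit (cball x d) f (\<lambda>s. deriv (\<phi> s) 0) sequentially"
    by (intro exI[of _ 1]) auto
qed simp

text \<open>Off the zeros of g the quotient f/g has derivative zero. Dividing the common zero at 0
  out of both functions makes the quotient continuous, hence constant, on a ball about 0, and the
  identity theorem carries the relation to the whole plane.\<close>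

lemma holomorphic_wronskian_zero_imp_proportional:
  fixes f g :: "complex \<Rightarrow> complex"
  assumes f: "f holomorphic_on UNIV" and g: "g holomorphic_on UNIV"
    and zero: "f 0 = 0" "g 0 = 0" and dg: "deriv g 0 \<noteq> 0"
    and wronskian: "\<And>t. deriv f t * g t = deriv g t * f t"
  shows "f t = deriv f 0 / deriv g 0 * g t"
proof -
  define p where "p = (\<lambda>t. if t = 0 then deriv f 0 else (f t - f 0) / (t - 0))"
  define q where "q = (\<lambda>t. if t = 0 then deriv g 0 else (g t - g 0) / (t - 0))"
  have holp: "p holomorphic_on UNIV" and holq: "q holomorphic_on UNIV"
    unfolding p_def q_def by (intro pole_lemma_open f g open_UNIV)+
  have fp: "f t = t * p t" and gq: "g t = t * q t" for t
    using zero by (auto simp: p_def q_def)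
  have "isCont q 0"
    using holomorphic_on_imp_continuous_on[OF holq] by (simp add: continuous_on_eq_continuous_at)
  then obtain r where r: "r > 0" "\<And>t. t \<in> ball 0 r \<Longrightarrow> q t \<noteq> 0"
    using continuous_at_avoid[of 0 q 0] dg by (auto simp: q_def dist_commute)
  have const: "p t / q t = p 0 / q 0" if "t \<in> ball 0 r" for t
  proof -
    have cont: "continuous_on (ball 0 r) (\<lambda>t. p t / q t)"
      using holp holq r
      by (intro continuous_intros holomorphic_on_imp_continuous_on) (auto intro: holomorphic_on_subset)
    have "((\<lambda>t. p t / q t) has_field_derivative 0) (at t)" if t: "t \<in> ball 0 r - {0}" for t
    proof -
      have gt: "g t \<noteq> 0" using t r(2)[of t] by (auto simp: gq)
      have "((\<lambda>t. f t / g t) has_field_derivative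
          (deriv f t * g t - f t * deriv g t) / (g t * g t)) (at t)"
        by (intro DERIV_divide holomorphic_derivI[OF f] holomorphic_derivI[OF g] gt) auto
      then have "((\<lambda>t. f t / g t) has_field_derivative 0) (at t)"
        using wronskian[of t] by (simp add: mult.commute)
      then show ?thesis
        by (rule has_field_derivative_transform_within_open[of _ _ _ "ball 0 r - {0}"])
          (use t in \<open>auto simp: fp gq open_delete\<close>)
    qed
    \<comment> \<open>The derivative is known only off 0; continuity lets 0 be treated as a finite
      exceptional set.\<close>
    then show ?thesis
      using DERIV_zero_connected_constant[OF connected_ball open_ball, of "{0}" 0 r "\<lambda>t. p t / q t"]
        cont \<open>t \<in> ball 0 r\<close> r(1) by (metis (no_types, lifting) centre_in_ball finite.emptyI finite_insert)
  qed
  have "f t - deriv f 0 / deriv g 0 * g t = 0"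
  proof (rule analytic_continuation[of "\<lambda>t. f t - deriv f 0 / deriv g 0 * g t" UNIV "ball 0 r" 0])
    show "(\<lambda>t. f t - deriv f 0 / deriv g 0 * g t) holomorphic_on UNIV"
      by (intro holomorphic_intros f g)
    show "(0::complex) islimpt ball 0 r" using r by (simp add: islimpt_ball)
    fix t assume t: "t \<in> ball (0::complex) r"
    then have "p t = deriv f 0 / deriv g 0 * q t"
      using const[OF t] r(2)[OF t] by (simp add: p_def q_def field_simps split: if_splits)
    then show "f t - deriv f 0 / deriv g 0 * g t = 0" by (simp add: fp gq)
  qed auto
  then show ?thesis by simp
qed

text \<open>The reciprocal of \<open>a t / t\<close> extends to a zero-free entire function of at most linear growth.\<close>

lemma entire_proper_single_zero_linear:
  fixes a :: "complex \<Rightarrow> complex"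
  assumes a: "a holomorphic_on UNIV" and "a 0 = 0" and da: "deriv a 0 \<noteq> 0"
    and nz: "\<And>t. t \<noteq> 0 \<Longrightarrow> a t \<noteq> 0"
    and "c > 0" and growth: "\<And>t. norm t \<ge> R \<Longrightarrow> norm (a t) \<ge> c"
  shows "a t = deriv a 0 * t"
proof -
  define b where "b = (\<lambda>t. if t = 0 then deriv a 0 else (a t - a 0) / (t - 0))"
  define q where "q = (\<lambda>t. inverse (b t))"
  have b: "b t \<noteq> 0" for t
    using da nz \<open>a 0 = 0\<close> by (auto simp: b_def)
  have "b holomorphic_on UNIV"
    unfolding b_def by (intro pole_lemma_open a open_UNIV)
  then have q: "q holomorphic_on UNIV"
    unfolding q_def using b by (intro holomorphic_intros) auto
  \<comment> \<open>Here q t = t / a t, and the maximum with 1 keeps t away from 0, where b takes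
    its special value.\<close>
  have bound: "norm (q t) \<le> inverse c * norm t ^ 1" if "norm t \<ge> max R 1" for t
  proof -
    have "t \<noteq> 0" using that by auto
    moreover have "norm t * c \<le> norm t * norm (a t)" using growth[of t] that by (intro mult_left_mono) auto
    ultimately show ?thesis using \<open>c > 0\<close> nz[of t] \<open>a 0 = 0\<close>
      by (simp add: q_def b_def norm_inverse norm_divide field_simps)
  qed
  have lin: "q t = q 0 + deriv q 0 * t" for t
    using Liouville_polynomial[OF q bound, of "max R 1" t] by simp
  \<comment> \<open>An affine function of nonzero slope has a zero, whereas q is a
    reciprocal.\<close>
  have "deriv q 0 = 0"
  proof (rule ccontr)
    assume "deriv q 0 \<noteq> 0"
    then have "q (- q 0 / deriv q 0) = 0" by (subst lin) simp
    then show False using b by (simp add: q_def)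
  qed
  then have "b t = b 0" using lin[of t] by (simp add: q_def)
  then show ?thesis using \<open>a 0 = 0\<close> by (auto simp: b_def field_simps split: if_splits)
qed

subsection \<open>The Hermitian product and entire maps\<close>

text \<open>Linear in the first slot, conjugate linear in the second. The real inner product is its
  real part; Levi matrix entries need the full complex value.\<close>

definition hprod :: "complex ^ 'n \<Rightarrow> complex ^ 'n \<Rightarrow> complex" where
  "hprod x y = (\<Sum>k\<in>UNIV. x $ k * cnj (y $ k))"

lemma hprod_add_left: "hprod (x + y) z = hprod x z + hprod y z"
  by (simp add: hprod_def algebra_simps sum.distrib)

lemma hprod_scale_left: "hprod (c *s x) y = c * hprod x y"
  by (simp add: hprod_def sum_distrib_left algebra_simps)

lemma hprod_scale_right: "hprod x (c *s y) = cnj c * hprod x y"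
  by (simp add: hprod_def sum_distrib_left algebra_simps)

lemma cnj_hprod: "cnj (hprod x y) = hprod y x"
  by (simp add: hprod_def mult.commute)

lemma hprod_diff_left: "hprod (x - y) z = hprod x z - hprod y z"
  by (simp add: hprod_def algebra_simps sum_subtractf)

lemma hprod_diff_right: "hprod x (y - z) = hprod x y - hprod x z"
  by (simp add: hprod_def algebra_simps sum_subtractf)

lemma hprod_sum_left: "hprod (\<Sum>i\<in>A. f i) y = (\<Sum>i\<in>A. hprod (f i) y)"
  by (induction A rule: infinite_finite_induct) (auto simp: hprod_add_left, auto simp: hprod_def)

lemma hprod_sum_right: "hprod y (\<Sum>i\<in>A. f i) = (\<Sum>i\<in>A. hprod y (f i))"
  by (simp flip: cnj_hprod[of _ y] add: hprod_sum_left)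

lemma inner_eq_Re_hprod: "x \<bullet> y = Re (hprod x y)" for x y :: "complex ^ 'n"
  by (simp add: hprod_def inner_vec_def inner_complex_def)

lemma hprod_self: "hprod x x = of_real ((norm x)\<^sup>2)"
proof -
  have "hprod x x = of_real (Re (hprod x x))"
    by (metis Reals_cnj_iff cnj_hprod of_real_Re)
  then show ?thesis
    by (simp only: inner_eq_Re_hprod[symmetric] power2_norm_eq_inner)
qed

lemma hprod_self_eq_0_iff: "hprod x x = 0 \<longleftrightarrow> x = 0"
  by (simp add: hprod_self)

text \<open>Conjugation is real linear, so the product rule applies to curves with a real parameter.
  Componentwise hypotheses match the one-variable derivatives obtained along complex lines.\<close>

lemma has_vector_derivative_hprod:
  assumes "\<And>k. ((\<lambda>t. p t $ k) has_vector_derivative p' $ k) (at x within S)"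
    and "\<And>k. ((\<lambda>t. q t $ k) has_vector_derivative q' $ k) (at x within S)"
  shows "((\<lambda>t. hprod (p t) (q t)) has_vector_derivative hprod (p x) q' + hprod p' (q x)) (at x within S)"
  unfolding hprod_def sum.distrib[symmetric]
  by (intro has_vector_derivative_sum has_vector_derivative_mult has_vector_derivative_cnj assms)

text \<open>The vector w is N times the part of y orthogonal to x, and its squared norm is N times
  the Cauchy-Schwarz defect. Parallelism is stated through 2 by 2 minors, which become Wronskians
  when y is the derivative of a curve x.\<close>

lemma hprod_Cauchy_Schwarz_eq:
  assumes "x \<noteq> 0" and "hprod y y * hprod x x = hprod y x * hprod x y"
  shows "y $ i * x $ j = y $ j * x $ i"
proof -
  define N where "N = hprod x x"
  have N: "N \<noteq> 0" "cnj N = N" using assms(1) by (simp_all add: N_def hprod_self_eq_0_iff cnj_hprod)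
  define w where "w = N *s y - hprod y x *s x"
  have "hprod w w = N * (N * hprod y y - hprod y x * hprod x y)"
    by (simp add: w_def hprod_diff_left hprod_diff_right hprod_scale_left hprod_scale_right
        cnj_hprod N(2) N_def[symmetric] algebra_simps)
  also have "\<dots> = 0" using assms(2) by (simp add: N_def mult.commute)
  finally have "N *s y = hprod y x *s x" by (simp add: hprod_self_eq_0_iff w_def)
  then have eq: "N * y $ k = hprod y x * x $ k" for k
    by (metis vector_smult_component)
  have "N * (y $ i * x $ j) = hprod y x * x $ i * x $ j" using eq[of i] by (simp flip: mult.assoc)
  also have "\<dots> = hprod y x * x $ j * x $ i" by simp
  also have "\<dots> = N * (y $ j * x $ i)" by (simp flip: eq)
  finally have "N * (y $ i * x $ j) = N * (y $ j * x $ i)" .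
  then show ?thesis using N by simp
qed

section \<open>Entire maps of several variables with their complex linear derivatives\<close>

locale cn_entire =
  fixes \<Phi> :: "complex ^ 'n \<Rightarrow> complex ^ 'm" and D :: "complex ^ 'n \<Rightarrow> complex ^ 'n \<Rightarrow> complex ^ 'm"
  assumes has_derivative: "(\<Phi> has_derivative D z) (at z)"
    and scale: "D z (c *s v) = c *s D z v"
begin

lemma linear_derivative: "linear (D z)"
  using has_derivative has_derivative_linear by blast

lemma continuous_on: "continuous_on S \<Phi>"
  using has_derivative by (meson continuous_at_imp_continuous_on has_derivative_continuous)

lemma has_field_derivative_line:
  "((\<lambda>s. \<Phi> (z + s *s v) $ k) has_field_derivative D (z + s *s v) v $ k) (at s)"
proof -
  have "linear (\<lambda>s::complex. s *s v)"
    by (rule linearI) (auto simp: vec_eq_iff algebra_simps)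
  then have "((\<lambda>s. z + s *s v) has_derivative (\<lambda>h. h *s v)) (at s)"
    using has_derivative_add[OF has_derivative_const linear_imp_has_derivative] by fastforce
  from has_derivative_compose[OF this has_derivative]
  have "((\<lambda>s. \<Phi> (z + s *s v)) has_derivative (\<lambda>h. D (z + s *s v) (h *s v))) (at s)" .
  from bounded_linear.has_derivative[OF bounded_linear_vec_nth this]
  show ?thesis by (simp add: has_field_derivative_def scale mult_commute_abs)
qed

text \<open>The locale gives first derivatives only, while the Levi matrix needs a second one. The
  partial derivative is the t-derivative at 0 of a jointly continuous, separately entire function of
  s and t.\<close>

lemma holomorphic_partial: "(\<lambda>s. D (z + s *s v) w $ k) holomorphic_on UNIV"
proof -
  define \<phi> where "\<phi> = (\<lambda>s t. \<Phi> (z + s *s v + t *s w) $ k)"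
  have "(\<lambda>s. deriv (\<phi> s) 0) holomorphic_on UNIV"
  proof (rule holomorphic_on_deriv_parameter)
    have "continuous_on UNIV (\<lambda>p. z + fst p *s v + snd p *s w)"
      unfolding vector_scalar_mult_def by (intro continuous_intros)
    then show "continuous_on UNIV (\<lambda>p. \<phi> (fst p) (snd p))"
      unfolding \<phi>_def
      by (intro continuous_on_component continuous_on_compose2[OF continuous_on[of UNIV]]) auto
    show "\<phi> s holomorphic_on UNIV" for s
      unfolding \<phi>_def holomorphic_on_def field_differentiable_def
      using has_field_derivative_line[of "z + s *s v" w k] by blast
    have "(\<lambda>s. \<Phi> (z + t *s w + s *s v) $ k) holomorphic_on UNIV" for t
      unfolding holomorphic_on_def field_differentiable_def
      using has_field_derivative_line[of "z + t *s w" v k] by blast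
    then show "(\<lambda>s. \<phi> s t) holomorphic_on UNIV" for t
      unfolding \<phi>_def by (simp only: add.assoc add.commute[of "_ *s v"])
  qed
  moreover have "deriv (\<phi> s) 0 = D (z + s *s v) w $ k" for s
    unfolding \<phi>_def using has_field_derivative_line[of "z + s *s v" w k 0]
    by (intro DERIV_imp_deriv) simp
  ultimately show ?thesis by simp
qed

end

subsection \<open>The Levi matrix of the logarithm of the norm\<close>

lemma scaleR_vector_smult: "t *\<^sub>R (c *s v) = (of_real t * c) *s v" for v :: "complex ^ 'n"
  by (simp add: vec_eq_iff) (simp add: scaleR_conv_of_real)

lemma has_vector_derivative_along_line:
  fixes g :: "complex \<Rightarrow> complex"
  assumes "(g has_field_derivative g') (at 0)"
  shows "((\<lambda>t::real. g (of_real t * c)) has_vector_derivative c * g') (at 0)"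
proof -
  have "((\<lambda>t::real. of_real t * c) has_vector_derivative c) (at 0)"
    by (auto intro!: derivative_eq_intros)
  from field_vector_diff_chain_at[OF this, of g g'] assms show ?thesis by (simp add: o_def)
qed

text \<open>For x the Hermitian product of \<open>\<Phi> w\<close> and
  \<open>D w (axis j 1)\<close>, the two real parts are the ones in the derivatives along
  \<open>axis j 1\<close> and \<open>axis j \<i>\<close>, so the combination in
  \<open>wirt_zbar\<close> restores x.\<close>

lemma complex_of_cartesian_real_parts: "of_real (Re x) + \<i> * of_real (Re (- \<i> * x)) = x"
  by (simp add: complex_eq_iff)

context cn_entire
begin

lemma wirt_zbar_ln_norm:
  assumes "\<Phi> w \<noteq> 0"
  shows "wirt_zbar j (\<lambda>w. of_real (ln (norm (\<Phi> w)))) w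
    = hprod (\<Phi> w) (D w (axis j 1)) / (2 * hprod (\<Phi> w) (\<Phi> w))"
proof -
  have dir: "dirderiv (\<lambda>w. of_real (ln (norm (\<Phi> w)))) w v
      = of_real (Re (hprod (\<Phi> w) (D w v))) / hprod (\<Phi> w) (\<Phi> w)" for v
  proof -
    have "((\<lambda>t. w + t *\<^sub>R v) has_derivative (\<lambda>h. h *\<^sub>R v)) (at 0)"
      by (auto intro!: derivative_eq_intros)
    from has_derivative_compose[OF this, of \<Phi> "D w"] has_derivative[of w]
    have "((\<lambda>t. \<Phi> (w + t *\<^sub>R v)) has_derivative (\<lambda>h. h *\<^sub>R D w v)) (at 0)"
      by (simp add: linear_cmul[OF linear_derivative])
    then have "((\<lambda>t. \<Phi> (w + t *\<^sub>R v) \<bullet> \<Phi> (w + t *\<^sub>R v)) has_derivative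
        (\<lambda>h. 2 * (\<Phi> w \<bullet> D w v) * h)) (at 0)"
      by (auto intro!: derivative_eq_intros simp: inner_commute)
    then have "((\<lambda>t. \<Phi> (w + t *\<^sub>R v) \<bullet> \<Phi> (w + t *\<^sub>R v)) has_real_derivative
        2 * (\<Phi> w \<bullet> D w v)) (at 0)"
      by (simp add: has_field_derivative_def mult_commute_abs)
    then have "((\<lambda>t. ln (\<Phi> (w + t *\<^sub>R v) \<bullet> \<Phi> (w + t *\<^sub>R v)) / 2) has_real_derivative
        (\<Phi> w \<bullet> D w v) / (\<Phi> w \<bullet> \<Phi> w)) (at 0)"
      using assms by (auto intro!: derivative_eq_intros simp: field_simps)
    \<comment> \<open>At x = 0 both sides are 0 because \<open>ln 0\<close> has the default value 0,
      so the identity may be rewritten along the whole line.\<close>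
    moreover have "ln (x \<bullet> x) / 2 = ln (norm x)" for x :: "complex ^ 'm"
      by (cases "x = 0") (simp_all add: dot_square_norm ln_realpow)
    ultimately have "((\<lambda>t. ln (norm (\<Phi> (w + t *\<^sub>R v)))) has_real_derivative
        (\<Phi> w \<bullet> D w v) / (\<Phi> w \<bullet> \<Phi> w)) (at 0)"
      by simp
    then have "((\<lambda>t. complex_of_real (ln (norm (\<Phi> (w + t *\<^sub>R v))))) has_vector_derivative
        of_real ((\<Phi> w \<bullet> D w v) / (\<Phi> w \<bullet> \<Phi> w))) (at 0)"
      by (intro has_vector_derivative_of_real)
    then have "dirderiv (\<lambda>w. of_real (ln (norm (\<Phi> w)))) w v = of_real ((\<Phi> w \<bullet> D w v) / (\<Phi> w \<bullet> \<Phi> w))"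
      unfolding dirderiv_def by (rule vector_derivative_at)
    then show ?thesis by (simp add: hprod_self dot_square_norm inner_eq_Re_hprod)
  qed
  have "axis j \<i> = \<i> *s axis j (1::complex)" by (auto simp: vec_eq_iff axis_def)
  then have i: "hprod (\<Phi> w) (D w (axis j \<i>)) = - \<i> * hprod (\<Phi> w) (D w (axis j 1))"
    by (simp add: scale hprod_scale_right)
  have "wirt_zbar j (\<lambda>w. of_real (ln (norm (\<Phi> w)))) w
      = (of_real (Re (hprod (\<Phi> w) (D w (axis j 1))))
        + \<i> * of_real (Re (- \<i> * hprod (\<Phi> w) (D w (axis j 1))))) / (2 * hprod (\<Phi> w) (\<Phi> w))"
    unfolding wirt_zbar_def dir i by (simp add: add_divide_distrib mult.commute)
  then show ?thesis by (simp only: complex_of_cartesian_real_parts)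
qed

text \<open>Differentiating the quotient of \<open>wirt_zbar_ln_norm\<close> in direction
  \<open>c *s axis i 1\<close> gives a part linear in c and a part conjugate linear in c. The
  operator \<open>wirt_z\<close> keeps only the linear coefficient; the second derivatives of
  \<open>\<Phi>\<close> occur only in the other one.\<close>

lemma levi_ln_norm:
  fixes z :: "complex ^ 'n"
  assumes "\<Phi> z \<noteq> 0"
  defines "N \<equiv> hprod (\<Phi> z) (\<Phi> z)"
  shows "levi (\<lambda>w. ln (norm (\<Phi> w))) z $ i $ j =
    (hprod (D z (axis i 1)) (D z (axis j 1)) * N
      - hprod (\<Phi> z) (D z (axis j 1)) * hprod (D z (axis i 1)) (\<Phi> z)) / (2 * N\<^sup>2)"
proof -
  define ei ej where "ei = axis i (1::complex)" and "ej = axis j (1::complex)"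
  define W where "W = wirt_zbar j (\<lambda>w. of_real (ln (norm (\<Phi> w))))"
  define q where "q = (\<lambda>s k. D (z + s *s ei) ej $ k)"
  \<comment> \<open>The mixed holomorphic second derivative of \<open>\<Phi>\<close> at z in the
    coordinates i and j.\<close>
  define R where "R = (\<chi> k. deriv (\<lambda>s. q s k) 0)"
  have N: "N \<noteq> 0" using assms by (simp add: hprod_self_eq_0_iff)
  \<comment> \<open>The formula for W is differentiated at z, so \<open>\<Phi>\<close> must be
    nonzero on a neighbourhood of z.\<close>
  have "isCont \<Phi> z"
    using continuous_on[of UNIV] by (simp add: continuous_on_eq_continuous_at)
  then obtain r where r: "r > 0" "\<And>w. dist z w < r \<Longrightarrow> \<Phi> w \<noteq> 0"
    using continuous_at_avoid[of z \<Phi> 0] assms(1) by blast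
  define \<alpha> where "\<alpha> = (hprod (D z ei) (D z ej) * N - hprod (\<Phi> z) (D z ej) * hprod (D z ei) (\<Phi> z)) / (2 * N\<^sup>2)"
  define \<beta> where "\<beta> = (hprod (\<Phi> z) R * N - hprod (\<Phi> z) (D z ej) * hprod (\<Phi> z) (D z ei)) / (2 * N\<^sup>2)"
  have dir: "dirderiv W z (c *s ei) = c * \<alpha> + cnj c * \<beta>" for c
  proof -
    define P where "P = (\<lambda>t::real. \<Phi> (z + t *\<^sub>R (c *s ei)))"
    define Q where "Q = (\<lambda>t::real. D (z + t *\<^sub>R (c *s ei)) ej)"
    have P0: "P 0 = \<Phi> z" and Q0: "Q 0 = D z ej" by (simp_all add: P_def Q_def)
    have dP: "((\<lambda>t. P t $ k) has_vector_derivative (c *s D z ei) $ k) (at 0)" for k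
      using has_vector_derivative_along_line[OF has_field_derivative_line[of z ei k 0, simplified], of c]
      by (simp add: P_def scaleR_vector_smult)
    have dQ: "((\<lambda>t. Q t $ k) has_vector_derivative (c *s R) $ k) (at 0)" for k
    proof -
      have "((\<lambda>s. q s k) has_field_derivative deriv (\<lambda>s. q s k) 0) (at 0)"
        unfolding q_def by (rule holomorphic_derivI[OF holomorphic_partial]) auto
      from has_vector_derivative_along_line[OF this, of c] show ?thesis
        by (simp add: Q_def q_def R_def scaleR_vector_smult)
    qed
    define n where "n = hprod (\<Phi> z) (c *s R) + hprod (c *s D z ei) (D z ej)"
    define d where "d = hprod (\<Phi> z) (c *s D z ei) + hprod (c *s D z ei) (\<Phi> z)"
    have "((\<lambda>t. hprod (P t) (Q t)) has_vector_derivative n) (at 0)"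
      using has_vector_derivative_hprod[OF dP dQ] by (simp add: n_def P0 Q0)
    moreover have "((\<lambda>t. 2 * hprod (P t) (P t)) has_vector_derivative 2 * d) (at 0)"
      using has_vector_derivative_hprod[OF dP dP]
      by (intro has_vector_derivative_mult_right) (simp add: d_def P0)
    ultimately have "((\<lambda>t. hprod (P t) (Q t) / (2 * hprod (P t) (P t))) has_vector_derivative
        (n * (2 * N) - hprod (\<Phi> z) (D z ej) * (2 * d)) / ((2 * N) * (2 * N))) (at 0)"
      unfolding has_vector_derivative_def
      by (rule has_derivative_divide'[THEN has_derivative_eq_rhs])
        (use N in \<open>auto simp: P0 Q0 N_def fun_eq_iff scaleR_conv_of_real algebra_simps diff_divide_distrib add_divide_distrib\<close>)
    then have "((\<lambda>t. W (z + t *\<^sub>R (c *s ei))) has_vector_derivative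
        (n * (2 * N) - hprod (\<Phi> z) (D z ej) * (2 * d)) / ((2 * N) * (2 * N))) (at 0)"
    proof (rule has_vector_derivative_transform_within_open)
      show "open ((\<lambda>t::real. z + t *\<^sub>R (c *s ei)) -` ball z r)"
        by (intro open_vimage continuous_intros open_ball)
      show "0 \<in> (\<lambda>t::real. z + t *\<^sub>R (c *s ei)) -` ball z r" using r by simp
      fix t :: real assume "t \<in> (\<lambda>t. z + t *\<^sub>R (c *s ei)) -` ball z r"
      then have "\<Phi> (z + t *\<^sub>R (c *s ei)) \<noteq> 0" using r(2) by simp
      then show "hprod (P t) (Q t) / (2 * hprod (P t) (P t)) = W (z + t *\<^sub>R (c *s ei))"
        by (simp add: W_def P_def Q_def wirt_zbar_ln_norm ej_def)
    qed
    then have "dirderiv W z (c *s ei) = (n * (2 * N) - hprod (\<Phi> z) (D z ej) * (2 * d)) / ((2 * N) * (2 * N))"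
      unfolding dirderiv_def by (rule vector_derivative_at)
    also have "\<dots> = c * \<alpha> + cnj c * \<beta>"
      using N by (simp add: n_def d_def \<alpha>_def \<beta>_def hprod_scale_left hprod_scale_right
          power2_eq_square field_simps)
    finally show ?thesis .
  qed
  have axis: "axis i 1 = 1 *s ei" "axis i \<i> = \<i> *s ei"
    by (auto simp: ei_def vec_eq_iff axis_def)
  have "levi (\<lambda>w. ln (norm (\<Phi> w))) z $ i $ j = wirt_z i W z"
    by (simp add: levi_def W_def)
  \<comment> \<open>The directions c = 1 and c = i give half of (\<alpha> + \<beta>) - i (i \<alpha>
    - i \<beta>), in which \<beta> cancels.\<close>
  also have "\<dots> = \<alpha>"
    unfolding wirt_z_def axis dir by (simp add: algebra_simps)
  finally show ?thesis by (simp add: \<alpha>_def ei_def ej_def)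
qed

lemma derivative_basis_expansion: "D z u = (\<Sum>i\<in>UNIV. u $ i *s D z (axis i 1))"
proof -
  have "D z u = D z (\<Sum>i\<in>UNIV. u $ i *s axis i 1)" by (simp add: basis_expansion)
  then show ?thesis by (simp add: linear_sum[OF linear_derivative] scale)
qed

text \<open>Sesquilinear expansion in the standard basis collects the matrix entries; the numerator
  becomes the Cauchy-Schwarz defect of \<open>D z u\<close> and \<open>\<Phi> z\<close>.\<close>

lemma levi_form_ln_norm:
  fixes z :: "complex ^ 'n"
  assumes "\<Phi> z \<noteq> 0"
  defines "N \<equiv> hprod (\<Phi> z) (\<Phi> z)"
  shows "(\<Sum>i\<in>UNIV. \<Sum>j\<in>UNIV. u $ i * cnj (u $ j) * levi (\<lambda>w. ln (norm (\<Phi> w))) z $ i $ j)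
    = (hprod (D z u) (D z u) * N - hprod (D z u) (\<Phi> z) * hprod (\<Phi> z) (D z u)) / (2 * N\<^sup>2)"
proof -
  have "(\<Sum>i\<in>UNIV. \<Sum>j\<in>UNIV. u $ i * cnj (u $ j) * levi (\<lambda>w. ln (norm (\<Phi> w))) z $ i $ j)
    = ((\<Sum>i\<in>UNIV. \<Sum>j\<in>UNIV. u $ i * cnj (u $ j) * hprod (D z (axis i 1)) (D z (axis j 1))) * N
      - (\<Sum>i\<in>UNIV. u $ i * hprod (D z (axis i 1)) (\<Phi> z))
        * (\<Sum>j\<in>UNIV. cnj (u $ j) * hprod (\<Phi> z) (D z (axis j 1)))) / (2 * N\<^sup>2)"
    unfolding levi_ln_norm[OF assms(1)] N_def[symmetric] sum_product
    unfolding sum_distrib_right sum_subtractf[symmetric] sum_divide_distrib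
    by (intro sum.cong refl) (simp add: algebra_simps)
  also have "(\<Sum>i\<in>UNIV. u $ i * hprod (D z (axis i 1)) (\<Phi> z)) = hprod (D z u) (\<Phi> z)"
    by (subst (2) derivative_basis_expansion) (simp add: hprod_sum_left hprod_scale_left)
  also have "(\<Sum>j\<in>UNIV. cnj (u $ j) * hprod (\<Phi> z) (D z (axis j 1))) = hprod (\<Phi> z) (D z u)"
    by (subst (2) derivative_basis_expansion) (simp add: hprod_sum_right hprod_scale_right)
  also have "(\<Sum>i\<in>UNIV. \<Sum>j\<in>UNIV. u $ i * cnj (u $ j) * hprod (D z (axis i 1)) (D z (axis j 1)))
      = hprod (D z u) (D z u)"
    by (subst (3 4) derivative_basis_expansion)
      (simp add: hprod_sum_left hprod_scale_left hprod_sum_right hprod_scale_right sum_distrib_left mult_ac, rule sum.swap)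
  finally show ?thesis .
qed

end

subsection \<open>Comparison of two normalised automorphisms\<close>

lemma norm_vector_smult: "norm (c *s v) = cmod c * norm v" for v :: "complex ^ 'n"
  by (simp add: norm_vec_def norm_mult L2_set_right_distrib)

lemma cn_entire_frechet_derivative:
  assumes "cn_holomorphic_on F UNIV"
  shows "cn_entire F (\<lambda>z. frechet_derivative F (at z))"
proof
  fix z c v
  obtain L where L: "(F has_derivative L) (at z)" "\<And>c v. L (c *s v) = c *s L v"
    using assms unfolding cn_holomorphic_on_def by blast
  then have "frechet_derivative F (at z) = L"
    using frechet_derivative_at by metis
  then show "(F has_derivative frechet_derivative F (at z)) (at z)"
    and "frechet_derivative F (at z) (c *s v) = c *s frechet_derivative F (at z) v"
    using L by simp_all
qed

lemma cn_entire_imp_holomorphic: "cn_entire F D \<Longrightarrow> cn_holomorphic_on F UNIV"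
  unfolding cn_entire_def cn_holomorphic_on_def by blast

lemma cn_entire_compose:
  assumes "cn_entire A DA" and "cn_entire B DB"
  shows "cn_entire (\<lambda>z. A (B z)) (\<lambda>z v. DA (B z) (DB z v))"
proof
  show "((\<lambda>z. A (B z)) has_derivative (\<lambda>v. DA (B z) (DB z v))) (at z)" for z
    using has_derivative_compose[OF cn_entire.has_derivative[OF assms(2)]
        cn_entire.has_derivative[OF assms(1)]] .
qed (simp add: cn_entire.scale[OF assms(1)] cn_entire.scale[OF assms(2)])

lemma cn_entire_derivative_right_inverse:
  assumes "cn_entire A DA" and "cn_entire B DB" and inverse: "\<And>w. A (B w) = w"
  shows "DA (B w) (DB w v) = v"
proof -
  have "((\<lambda>z. z) has_derivative (\<lambda>v. DA (B w) (DB w v))) (at w)"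
    using cn_entire.has_derivative[OF cn_entire_compose[OF assms(1,2)]] inverse by simp
  from has_derivative_unique[OF this has_derivative_ident]
  show ?thesis by (simp add: fun_eq_iff)
qed

text \<open>Covers both the affine map applied after F in \<open>Theta F\<close> and the one applied
  before \<open>inv F\<close> in its inverse.\<close>

lemma cn_entire_affine:
  assumes "linear L" and "\<And>c v. L (c *s v) = c *s L v"
  shows "cn_entire (\<lambda>z. L (z - a) + b) (\<lambda>_. L)"
proof
  show "((\<lambda>z. L (z - a) + b) has_derivative L) (at z)" for z
    using has_derivative_compose[OF has_derivative_diff[OF has_derivative_ident has_derivative_const]
        linear_imp_has_derivative[OF assms(1)]]
    by (auto intro!: derivative_eq_intros)
qed (fact assms)

lemma levi_ln_norm_eq_imp_eq:
  fixes \<Phi> \<Psi> :: "complex ^ 'n \<Rightarrow> complex ^ 'n"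
  assumes bi: "biholomorphic \<Phi>" "biholomorphic \<Psi>"
    and zero: "\<Phi> 0 = 0" "\<Psi> 0 = 0"
    and tangent: "(\<Phi> has_derivative (\<lambda>v. v)) (at 0)" "(\<Psi> has_derivative (\<lambda>v. v)) (at 0)"
    and levi: "\<And>z. z \<noteq> 0 \<Longrightarrow>
      levi (\<lambda>w. ln (norm (\<Phi> w))) z = levi (\<lambda>w. ln (norm (\<Psi> w))) z"
  shows "\<Phi> = \<Psi>"
proof -
  have bij: "bij \<Phi>" "bij \<Psi>" using bi by (auto simp: biholomorphic_def)
  note inv_simps = bij_is_inj[OF bij(1), THEN inv_f_f] bij_is_inj[OF bij(2), THEN inv_f_f]
    bij_is_surj[OF bij(1), THEN surj_f_inv_f] bij_is_surj[OF bij(2), THEN surj_f_inv_f]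
  define DP DQ DJ where "DP = (\<lambda>z. frechet_derivative \<Phi> (at z))"
    and "DQ = (\<lambda>z. frechet_derivative \<Psi> (at z))"
    and "DJ = (\<lambda>z. frechet_derivative (inv \<Psi>) (at z))"
  interpret P: cn_entire \<Phi> DP
    unfolding DP_def using bi by (intro cn_entire_frechet_derivative) (simp add: biholomorphic_def)
  interpret Q: cn_entire \<Psi> DQ
    unfolding DQ_def using bi by (intro cn_entire_frechet_derivative) (simp add: biholomorphic_def)
  interpret J: cn_entire "inv \<Psi>" DJ
    unfolding DJ_def using bi by (intro cn_entire_frechet_derivative) (simp add: biholomorphic_def)
  interpret PI: cn_entire "inv \<Phi>" "\<lambda>z. frechet_derivative (inv \<Phi>) (at z)"
    using bi by (intro cn_entire_frechet_derivative) (simp add: biholomorphic_def)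
  interpret C: cn_entire "\<lambda>w. \<Phi> (inv \<Psi> w)" "\<lambda>w v. DP (inv \<Psi> w) (DJ w v)"
    by (rule cn_entire_compose) unfold_locales
  have QJ: "DQ (inv \<Psi> w) (DJ w v) = v" for w v
    by (rule cn_entire_derivative_right_inverse) (unfold_locales, simp add: inv_simps)
  have J0: "inv \<Psi> 0 = 0" using inv_simps(2)[of 0] zero by simp
  have "DP 0 = (\<lambda>v. v)" "DQ 0 = (\<lambda>v. v)"
    using has_derivative_unique P.has_derivative Q.has_derivative tangent by blast+
  then have D0: "DP 0 (DJ 0 v) = v" for v using QJ[of 0 v] J0 by simp
  \<comment> \<open>Properness: the points that \<open>\<Phi>\<close> after
    \<open>inv \<Psi>\<close> sends into the closed unit ball form the image of that compact ball
    under \<open>\<Psi>\<close> after \<open>inv \<Phi>\<close>.\<close>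
  have bounded: "\<exists>B. \<forall>w. norm (\<Phi> (inv \<Psi> w)) \<le> 1 \<longrightarrow> norm w \<le> B"
  proof -
    have "continuous_on UNIV (\<lambda>y. \<Psi> (inv \<Phi> y))"
      by (rule continuous_on_compose2[OF Q.continuous_on[of UNIV] PI.continuous_on]) simp
    then have "compact ((\<lambda>y. \<Psi> (inv \<Phi> y)) ` cball 0 1)"
      by (rule compact_continuous_image[OF continuous_on_subset[OF _ subset_UNIV] compact_cball])
    from compact_imp_bounded[OF this]
    obtain B where "\<forall>x\<in>(\<lambda>y. \<Psi> (inv \<Phi> y)) ` cball 0 1. norm x \<le> B"
      unfolding bounded_iff by blast
    then have B: "norm (\<Psi> (inv \<Phi> y)) \<le> B" if "norm y \<le> 1" for y
      using that by simp
    have "norm w \<le> B" if "norm (\<Phi> (inv \<Psi> w)) \<le> 1" for w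
      using B[OF that] by (simp add: inv_simps)
    then show ?thesis by blast
  qed
  have "\<Phi> (inv \<Psi> v) = v" for v
  proof (cases "v = 0")
    case True
    then show ?thesis using J0 zero by simp
  next
    case False
    \<comment> \<open>A nonzero coordinate of v, used to read off the scalar factor a of the curve
      f.\<close>
    then obtain j where j: "v $ j \<noteq> 0" by (auto simp: vec_eq_iff)
    define f where "f = (\<lambda>t. \<Phi> (inv \<Psi> (t *s v)))"
    have df: "((\<lambda>t. f t $ k) has_field_derivative DP (inv \<Psi> (t *s v)) (DJ (t *s v) v) $ k) (at t)" for t k
      using C.has_field_derivative_line[of 0 v k t] by (simp add: f_def)
    then have holf: "(\<lambda>t. f t $ k) holomorphic_on UNIV" for k
      unfolding holomorphic_on_def field_differentiable_def by blast
    have deriv_f: "deriv (\<lambda>t. f t $ k) t = DP (inv \<Psi> (t *s v)) (DJ (t *s v) v) $ k" for t k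
      using df by (rule DERIV_imp_deriv)
    have f0: "f 0 = 0" by (simp add: f_def J0 zero)
    have deriv_f0: "deriv (\<lambda>t. f t $ k) 0 = v $ k" for k
      by (simp add: deriv_f J0 D0)
    have nz: "inv \<Psi> (t *s v) \<noteq> 0" "f t \<noteq> 0" if "t \<noteq> 0" for t
    proof -
      show *: "inv \<Psi> (t *s v) \<noteq> 0"
        using inv_simps(4)[of "t *s v"] zero False that by auto
      show "f t \<noteq> 0"
        using * inv_simps(1)[of "inv \<Psi> (t *s v)"] inv_simps(1)[of 0] zero by (auto simp: f_def)
    qed
    have wronskian: "deriv (\<lambda>t. f t $ i) t * f t $ k = deriv (\<lambda>t. f t $ k) t * f t $ i" for i k t
    proof (cases "t = 0")
      case True
      then show ?thesis by (simp add: f0)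
    next
      case t: False
      \<comment> \<open>Chosen so that \<open>\<Psi> z\<close> = t v and \<open>DQ z u\<close> = v
        are parallel: the Levi form of log of the norm of \<open>\<Psi>\<close> vanishes at z in
        direction u.\<close>
      define z u where "z = inv \<Psi> (t *s v)" and "u = DJ (t *s v) v"
      have z: "\<Psi> z = t *s v" "DQ z u = v" "\<Phi> z = f t"
        by (simp_all add: z_def u_def inv_simps QJ f_def)
      have "\<Psi> z \<noteq> 0" using t False by (simp add: z)
      have "(hprod (DP z u) (DP z u) * hprod (f t) (f t)
          - hprod (DP z u) (f t) * hprod (f t) (DP z u)) / (2 * (hprod (f t) (f t))\<^sup>2) = 0"
        using P.levi_form_ln_norm[of z u] Q.levi_form_ln_norm[OF \<open>\<Psi> z \<noteq> 0\<close>, of u]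
          levi[of z] nz[OF t] by (simp add: z z_def[symmetric] hprod_scale_left hprod_scale_right)
      then have "hprod (DP z u) (DP z u) * hprod (f t) (f t) = hprod (DP z u) (f t) * hprod (f t) (DP z u)"
        using nz(2)[OF t] by (simp add: hprod_self_eq_0_iff)
      from hprod_Cauchy_Schwarz_eq[OF nz(2)[OF t] this]
      show ?thesis by (simp add: deriv_f z_def u_def)
    qed
    define a where "a = (\<lambda>t. f t $ j / v $ j)"
    have fa: "f t = a t *s v" for t
    proof (subst vec_eq_iff, intro allI)
      fix k
      \<comment> \<open>Components k and j of f both vanish at 0 and have derivatives
        \<open>v $ k\<close> and \<open>v $ j\<close> there, which fixes the ratio.\<close>
      have "f t $ k = v $ k / v $ j * f t $ j"
        using holomorphic_wronskian_zero_imp_proportional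
          [where f = "\<lambda>t. f t $ k" and g = "\<lambda>t. f t $ j" and t = t, OF holf holf _ _ _ wronskian] j
        by (simp add: f0 deriv_f0)
      then show "f t $ k = (a t *s v) $ k" by (simp add: a_def)
    qed
    have da: "deriv a 0 = 1"
    proof -
      have "((\<lambda>t. f t $ j) has_field_derivative v $ j) (at 0)"
        using df[of j 0] by (simp add: J0 D0)
      from DERIV_cdivide[OF this, of "v $ j"] show ?thesis
        using j by (intro DERIV_imp_deriv) (simp add: a_def)
    qed
    obtain B where B: "\<And>w. norm (\<Phi> (inv \<Psi> w)) \<le> 1 \<Longrightarrow> norm w \<le> B"
      using bounded by blast
    \<comment> \<open>The value at t = 1 suffices, as f 1 is the image of v. For |t| at least (B +
      1)/|v| the norm of t v exceeds B, so f t has norm above 1 and |a t| is above 1/|v|.\<close>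
    have "a 1 = deriv a 0 * 1"
    proof (rule entire_proper_single_zero_linear)
      show "a holomorphic_on UNIV"
        unfolding a_def using j by (intro holomorphic_intros holf) auto
      show "a 0 = 0" by (simp add: a_def f0)
      show "deriv a 0 \<noteq> 0" by (simp add: da)
      show "a t \<noteq> 0" if "t \<noteq> 0" for t
        using nz(2)[OF that] by (auto simp: fa)
      show "0 < inverse (norm v)" using False by simp
      fix t :: complex
      assume "(B + 1) / norm v \<le> norm t"
      then have "norm (t *s v) > B"
        using False by (simp add: norm_vector_smult field_simps)
      then have "norm (f t) > 1"
        using B[of "t *s v"] by (fastforce simp: f_def)
      then show "inverse (norm v) \<le> norm (a t)"
        using False by (simp add: fa norm_vector_smult field_simps)
    qed
    then show ?thesis using fa[of 1] da by (simp add: f_def)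
  qed
  then have "\<Phi> z = \<Psi> z" for z
    by (metis inv_simps(2))
  then show ?thesis by blast
qed

section \<open>The normalisation \<open>Theta F\<close>\<close>

context
  fixes F :: "complex ^ 'n \<Rightarrow> complex ^ 'n"
  assumes biholomorphic: "biholomorphic F"
begin

text \<open>Differentiating both compositions of F and \<open>inv F\<close> shows that
  \<open>DI (F 0)\<close> inverts \<open>DF 0\<close>. So \<open>Theta F\<close> is a composition of
  entire maps with derivative \<open>DI (F 0)\<close> after \<open>DF 0\<close>, the identity, at
  0.\<close>

lemma bij_DF0: "bij (DF0 F)"
  and cn_entire_Theta: "\<exists>D. cn_entire (Theta F) D \<and> D 0 = (\<lambda>v. v)"
  and biholomorphic_Theta: "biholomorphic (Theta F)"
proof -
  have "bij F" using biholomorphic by (simp add: biholomorphic_def)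
  then have inv_F: "inv F (F z) = z" "F (inv F z) = z" for z
    by (simp_all add: bij_is_inj bij_is_surj surj_f_inv_f)
  define DF DI where "DF = (\<lambda>z. frechet_derivative F (at z))"
    and "DI = (\<lambda>z. frechet_derivative (inv F) (at z))"
  have F: "cn_entire F DF" and I: "cn_entire (inv F) DI"
    using biholomorphic unfolding DF_def DI_def biholomorphic_def
    by (auto intro: cn_entire_frechet_derivative)
  have DF0: "DF0 F = DF 0" by (simp add: DF0_def DF_def)
  have DD: "DF 0 (DI (F 0) v) = v" "DI (F 0) (DF 0 v) = v" for v
    using cn_entire_derivative_right_inverse[OF F I, of "F 0" v]
      cn_entire_derivative_right_inverse[OF I F, of 0 v] by (simp_all add: inv_F)
  then show "bij (DF0 F)"
    unfolding DF0 by (intro o_bij[of "DI (F 0)"]) (auto simp: fun_eq_iff)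
  have inv: "inv (DF0 F) = DI (F 0)"
    unfolding DF0 by (rule inv_equality) (simp_all add: DD)
  have lin: "linear (DI (F 0))" "linear (DF 0)"
    using I F by (simp_all add: cn_entire.linear_derivative)
  have "cn_entire (\<lambda>z. DI (F 0) (z - F 0) + 0) (\<lambda>_. DI (F 0))"
    using lin cn_entire.scale[OF I] by (intro cn_entire_affine)
  from cn_entire_compose[OF this F]
  have Theta: "cn_entire (Theta F) (\<lambda>z v. DI (F 0) (DF z v))"
    by (simp add: Theta_def[abs_def] inv)
  then show "\<exists>D. cn_entire (Theta F) D \<and> D 0 = (\<lambda>v. v)"
    using DD by (intro exI[of _ "\<lambda>z v. DI (F 0) (DF z v)"]) auto
  \<comment> \<open>The inverse of \<open>Theta F\<close>, found by solving w =
    \<open>Theta F z\<close> for z.\<close>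
  define H where "H = (\<lambda>w. inv F (DF 0 (w - 0) + F 0))"
  have "cn_entire (\<lambda>w. DF 0 (w - 0) + F 0) (\<lambda>_. DF 0)"
    using lin cn_entire.scale[OF F] by (intro cn_entire_affine)
  from cn_entire_compose[OF I this] have H: "cn_entire H (\<lambda>z v. DI (DF 0 (z - 0) + F 0) (DF 0 v))"
    unfolding H_def .
  have HT: "H (Theta F z) = z" "Theta F (H w) = w" for z w
    by (simp_all add: H_def Theta_def inv DD inv_F)
  have "bij (Theta F)"
    by (rule o_bij[of H]) (auto simp: fun_eq_iff HT)
  moreover have "inv (Theta F) = H"
    by (rule inv_equality) (simp_all add: HT)
  ultimately show "biholomorphic (Theta F)"
    using Theta H by (simp add: biholomorphic_def cn_entire_imp_holomorphic)
qed

lemma Theta_0: "Theta F 0 = 0"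
  using cn_entire.linear_derivative[OF cn_entire_frechet_derivative[of F]] bij_DF0 biholomorphic
  by (simp add: Theta_def DF0_def biholomorphic_def)
    (metis bij_is_inj inv_f_f linear_0)

lemma has_derivative_Theta_0: "(Theta F has_derivative (\<lambda>v. v)) (at 0)"
  using cn_entire_Theta cn_entire.has_derivative by metis

end

theorem theorem1:
  fixes F G :: "complex ^ 'n \<Rightarrow> complex ^ 'n"
  assumes "biholomorphic F" and "biholomorphic G"
    and "F 0 = G 0"
    and "DF0 F = DF0 G"
    and "\<forall>z. z \<noteq> 0 \<longrightarrow>
           levi (\<lambda>w. ln (norm (Theta F w))) z = levi (\<lambda>w. ln (norm (Theta G w))) z"
  shows "F = G"
proof
  fix z
  have "Theta F = Theta G"
    using assms by (intro levi_ln_norm_eq_imp_eq biholomorphic_Theta Theta_0 has_derivative_Theta_0) auto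
  \<comment> \<open>The shared values at 0 and shared derivatives undo the normalisation:
    \<open>DF0 G\<close> cancels its inverse.\<close>
  then have "inv (DF0 G) (F z - G 0) = inv (DF0 G) (G z - G 0)"
    using assms(3,4) by (metis Theta_def)
  then have "F z - G 0 = G z - G 0"
    by (metis bij_DF0[OF assms(2)] bij_is_surj surj_f_inv_f)
  then show "F z = G z" by simp
qed

end
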